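(* Let $\alpha_1,\dots,\alpha_n$ be distinct nonzero elements of $\mathbb{F}_q$, let $w_1,\dots,w_n\in\mathbb{F}_q^*$, let $f(x)\in\mathbb{F}_q[x]$, let $1\le t<n$, and let $C\subseteq\mathbb{F}_q^n$ be the $[n,n-t,d]$ code with parity-check matrix $H$ (a $t\times n$ matrix of rank $t$, defined in the context). Assume that either $d=t$, or $d=t+1$ and $t$ is odd. Let $\boldsymbol r=(r_1,\dots,r_n)\in\mathbb{F}_q^n$ satisfy $d(\boldsymbol r,C)\le\lfloor\frac{d-1}{2}\rfloor$, let $J$ be the error location set of $\boldsymbol r$, and let $S(x)=\sum_{i=0}^{t-2}s_ix^i$ with $s_i=\sum_{j=1}^n r_jw_j\alpha_j^i$ be its syndrome polynomial. Then there is a pair of polynomials $(\sigma(x),\tau(x))$ over $\mathbb{F}_q$ satisfying $$S(x)\sigma(x)\equiv\tau(x)\pmod{x^{t-1}},$$ $$\gcd(\sigma(x),\tau(x))=1,\qquad \deg\tau(x)<\deg\sigma(x)=|J|\le\Big\lfloor\frac{d-1}{2}\Big\rfloor,$$ and this pair is unique up to the leading coefficient of $\sigma(x)$; that is, any two such pairs $(\sigma^{(1)},\tau^{(1)})$, $(\sigma^{(2)},\tau^{(2)})$ satisfy $\sigma^{(1)}=\lambda\sigma^{(2)}$ and $\tau^{(1)}=\lambda\tau^{(2)}$ for some $\lambda\in\mathbb{F}_q^*$.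
   Context: $\mathbb{F}_q$ is the finite field with $q$ elements. The matrix $H$ is the $t\times n$ matrix whose rows are $(w_1\alpha_1^i,\dots,w_n\alpha_n^i)$ for $0\le i\le t-2$, followed by the last row $\big(w_1(\alpha_1^{t-1}+f(\alpha_1)),\dots,w_n(\alpha_n^{t-1}+f(\alpha_n))\big)$. $C=\{\boldsymbol c\in\mathbb{F}_q^n: H\boldsymbol c^T=0\}$, and its minimum Hamming distance $d$ is $t$ or $t+1$ (almost-MDS or MDS). $d(\boldsymbol r,C)$ is the minimum Hamming distance from $\boldsymbol r$ to a codeword of $C$. When $d(\boldsymbol r,C)\le\lfloor\frac{d-1}{2}\rfloor$ there is a unique $\boldsymbol c\in C$ at this distance; writing $\boldsymbol r=\boldsymbol c+\boldsymbol e$ with error word $\boldsymbol e=(e_1,\dots,e_n)$, the error location set is $J=\{j: e_j\ne0\}$. Convention: $\deg 0=-\infty$. *)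

theory Defs
  imports
    "Jordan_Normal_Form.DL_Rank"
    "Jordan_Normal_Form.Matrix_Kernel"
    "HOL-Number_Theory.Cong"
    "HOL-Library.Extended_Real"
begin

text \<open>Vectors of length \<open>n\<close> are elements of \<^term>\<open>carrier_vec n\<close>; positions are numbered
  from \<open>0\<close> to \<open>n - 1\<close>.\<close>

definition parity_matrix ::
    "nat \<Rightarrow> nat \<Rightarrow> (nat \<Rightarrow> 'a::field) \<Rightarrow> (nat \<Rightarrow> 'a) \<Rightarrow> 'a poly \<Rightarrow> 'a mat" where
  "parity_matrix t n \<alpha> w f =
     mat t n (\<lambda>(i, j). if i = t - 1 then w j * (\<alpha> j ^ (t - 1) + poly f (\<alpha> j))
                       else w j * \<alpha> j ^ i)"

definition hamming_dist :: "'a vec \<Rightarrow> 'a vec \<Rightarrow> nat" where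
  "hamming_dist x y = card {j. j < dim_vec x \<and> x $ j \<noteq> y $ j}"

definition min_distance :: "'a vec set \<Rightarrow> nat" where
  "min_distance C = Min {hamming_dist x y | x y. x \<in> C \<and> y \<in> C \<and> x \<noteq> y}"

definition dist_to_code :: "'a vec \<Rightarrow> 'a vec set \<Rightarrow> nat" where
  "dist_to_code r C = Min {hamming_dist r c | c. c \<in> C}"

text \<open>Only meaningful for words within half the minimum distance of the code, where the
  closest codeword is unique.\<close>

definition closest_codeword :: "'a vec \<Rightarrow> 'a vec set \<Rightarrow> 'a vec" where
  "closest_codeword r C = (THE c. c \<in> C \<and> hamming_dist r c = dist_to_code r C)"

definition error_word :: "'a::ab_group_add vec \<Rightarrow> 'a vec set \<Rightarrow> 'a vec" where
  "error_word r C = r - closest_codeword r C"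

definition error_locations :: "'a::ab_group_add vec \<Rightarrow> 'a vec set \<Rightarrow> nat set" where
  "error_locations r C = {j. j < dim_vec r \<and> error_word r C $ j \<noteq> 0}"

text \<open>The sum over \<open>i < t - 1\<close> is the sum over \<open>0 \<le> i \<le> t - 2\<close>, and is empty for \<open>t = 1\<close>.\<close>

definition syndrome_poly ::
    "nat \<Rightarrow> nat \<Rightarrow> (nat \<Rightarrow> 'a::field) \<Rightarrow> (nat \<Rightarrow> 'a) \<Rightarrow> 'a vec \<Rightarrow> 'a poly" where
  "syndrome_poly t n \<alpha> w r =
     (\<Sum>i<t - 1. Polynomial.monom (\<Sum>j<n. r $ j * w j * \<alpha> j ^ i) i)"

text \<open>The library has \<open>degree 0 = 0\<close>; here the zero polynomial has degree \<open>-\<infinity>\<close>.\<close>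

definition deg_inf :: "'a::zero poly \<Rightarrow> ereal" where
  "deg_inf p = (if p = 0 then -\<infinity> else ereal (real (Polynomial.degree p)))"

definition key_pair ::
    "nat \<Rightarrow> nat \<Rightarrow> nat set \<Rightarrow> 'a::field poly \<Rightarrow> 'a poly \<Rightarrow> 'a poly \<Rightarrow> bool" where
  "key_pair t d J S \<sigma> \<tau> \<longleftrightarrow>
     [S * \<sigma> = \<tau>] (mod Polynomial.monom 1 (t - 1)) \<and>
     coprime \<sigma> \<tau> \<and>
     deg_inf \<tau> < deg_inf \<sigma> \<and>
     deg_inf \<sigma> = ereal (real (card J)) \<and>
     card J \<le> (d - 1) div 2"

end

theory Submission
  imports Defs
begin

text \<open>
  The syndromes depend only on the error word \<open>e\<close>, so the syndrome polynomial is the truncation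
  of \<open>\<Sum>j\<in>J. e j w j / (1 - \<alpha> j x)\<close>. Clearing denominators gives the pair
  \<open>\<sigma> = \<Prod>j\<in>J. (1 - \<alpha> j x)\<close> and
  \<open>\<tau> = \<Sum>j\<in>J. e j w j (\<Prod>k\<in>J - {j}. (1 - \<alpha> k x))\<close>, which is coprime because \<open>\<tau>\<close> does not
  vanish at the roots of \<open>\<sigma>\<close>. For two pairs, \<open>\<sigma>1 \<tau>2\<close> and \<open>\<sigma>2 \<tau>1\<close> agree modulo \<open>x ^ (t - 1)\<close>
  and both have degree below \<open>2 |J| \<le> t - 1\<close>, so they are equal, and coprimality forces
  proportionality.
\<close>

section \<open>Coprimality through Bezout identities\<close>

text \<open>The library develops coprimality in classes with a normalised gcd, of which polynomials over
  an arbitrary field are not an instance. Bezout's identity serves instead.\<close>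

lemma coprime_bezout:
  fixes a b :: "'a::euclidean_ring"
  shows "coprime a b \<longleftrightarrow> (\<exists>u v. u * a + v * b = 1)"
proof
  assume cop: "coprime a b"
  define I where "I = {u * a + v * b | u v. True}"
  have mem: "u * a + v * b \<in> I" for u v
    unfolding I_def by blast
  have aI: "a \<in> I" and bI: "b \<in> I"
    using mem[of 1 0] mem[of 0 1] by simp_all
  have "a \<noteq> 0 \<or> b \<noteq> 0"
    using cop by auto
  then have "\<exists>x. x \<in> I \<and> x \<noteq> 0"
    using aI bI by blast
  \<comment> \<open>A nonzero element \<open>g\<close> of least size divides everything in the ideal
    \<open>I\<close>: a remainder modulo \<open>g\<close> lies in \<open>I\<close> and is smaller,
    hence is 0.\<close>
  then obtain g where g: "g \<in> I" "g \<noteq> 0"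
    and least: "\<And>y. y \<in> I \<Longrightarrow> y \<noteq> 0 \<Longrightarrow> euclidean_size g \<le> euclidean_size y"
    by (metis (mono_tags, lifting) ex_has_least_nat[of "\<lambda>x. x \<in> I \<and> x \<noteq> 0" _ euclidean_size])
  from g obtain u v where uv: "g = u * a + v * b"
    unfolding I_def by blast
  have g_dvd: "g dvd x" if x: "x \<in> I" for x
  proof -
    from x obtain p q where pq: "x = p * a + q * b"
      unfolding I_def by blast
    have "x mod g = x - x div g * g"
      by (simp add: minus_div_mult_eq_mod)
    also have "\<dots> = (p * a + q * b) - x div g * (u * a + v * b)"
      by (simp only: pq[symmetric] uv[symmetric])
    also have "\<dots> = (p - x div g * u) * a + (q - x div g * v) * b"
      by (simp add: algebra_simps)
    finally have "x mod g \<in> I"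
      using mem by metis
    then have "x mod g = 0"
      using least[of "x mod g"] mod_size_less[OF g(2), of x] by fastforce
    then show ?thesis by blast
  qed
  have "is_unit g"
    using cop g_dvd[OF aI] g_dvd[OF bI] coprime_common_divisor by blast
  then obtain k where "1 = g * k" by blast
  then have "(k * u) * a + (k * v) * b = 1"
    using uv by (simp add: algebra_simps)
  then show "\<exists>u v. u * a + v * b = 1" by blast
next
  assume "\<exists>u v. u * a + v * b = 1"
  then obtain u v where uv: "u * a + v * b = 1" by blast
  show "coprime a b"
  proof (rule coprimeI)
    fix c assume "c dvd a" "c dvd b"
    then have "c dvd u * a + v * b" by simp
    then show "is_unit c" by (simp add: uv)
  qed
qed

text \<open>In the product of the two Bezout identities, every term other than the multiple of
  \<open>a * b\<close> is a multiple of \<open>c\<close>.\<close>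

lemma coprime_mult_left_euclidean:
  fixes a b c :: "'a::euclidean_ring"
  assumes "coprime a c" and "coprime b c"
  shows "coprime (a * b) c"
proof -
  from assms obtain u v p q where "u * a + v * c = 1" and "p * b + q * c = 1"
    unfolding coprime_bezout by blast
  then have "(u * a + v * c) * (p * b + q * c) = 1" by simp
  then have "(u * p) * (a * b) + (u * a * q + v * p * b + v * c * q) * c = 1"
    by (simp add: algebra_simps)
  then show ?thesis
    unfolding coprime_bezout by blast
qed

lemma coprime_prod_left_euclidean:
  fixes g :: "'b \<Rightarrow> 'a::euclidean_ring"
  assumes "\<And>i. i \<in> A \<Longrightarrow> coprime (g i) c"
  shows "coprime (prod g A) c"
  using assms
  by (induction A rule: infinite_finite_induct) (auto intro: coprime_mult_left_euclidean)

lemma coprime_dvd_mult_euclidean: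
  fixes a b c :: "'a::euclidean_ring"
  assumes "coprime a b" and "a dvd c * b"
  shows "a dvd c"
proof -
  from assms(1) obtain u v where "u * a + v * b = 1"
    unfolding coprime_bezout by blast
  then have "c = (c * u) * a + v * (c * b)"
    by (metis (no_types, lifting) distrib_left mult.assoc mult.left_commute mult.right_neutral)
  with assms(2) show ?thesis
    by (metis dvd_add dvd_mult dvd_triv_right)
qed

text \<open>Up to a unit, \<open>1 - a x\<close> is \<open>x - inverse a\<close>, modulo which
  \<open>p\<close> is the nonzero constant \<open>poly p (inverse a)\<close>.\<close>

lemma coprime_linear_poly:
  fixes p :: "'a::field poly"
  assumes "a \<noteq> 0" and "poly p (inverse a) \<noteq> 0"
  shows "coprime [:1, - a:] p"
proof (rule coprimeI)
  fix g assume g: "g dvd [:1, - a:]" "g dvd p"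
  have "[:1, - a:] dvd Polynomial.smult (- a) [:- inverse a, 1:]"
    using assms(1) by simp
  then have "[:1, - a:] dvd [:- inverse a, 1:]"
    by (rule dvd_smult_cancel) (use assms(1) in simp)
  moreover have "[:- inverse a, 1:] dvd p - [:poly p (inverse a):]"
    by (simp add: poly_eq_0_iff_dvd[symmetric])
  ultimately have "g dvd p - [:poly p (inverse a):]"
    using g(1) dvd_trans by blast
  then have "g dvd [:poly p (inverse a):]"
    using dvd_diff[OF g(2)] by fastforce
  then show "is_unit g"
    using assms(2) dvd_trans is_unit_const_poly_iff dvd_field_iff by blast
qed

section \<open>Error locator and error evaluator polynomials\<close>

definition error_locator :: "('b \<Rightarrow> 'a::field) \<Rightarrow> 'b set \<Rightarrow> 'a poly" where
  "error_locator \<alpha> J = (\<Prod>j\<in>J. [:1, - \<alpha> j:])"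

text \<open>The numerator of the sum of the fractions \<open>b j / (1 - \<alpha> j x)\<close> over
  the common denominator \<open>error_locator \<alpha> J\<close>.\<close>

definition error_evaluator :: "('b \<Rightarrow> 'a::field) \<Rightarrow> ('b \<Rightarrow> 'a) \<Rightarrow> 'b set \<Rightarrow> 'a poly" where
  "error_evaluator \<alpha> b J = (\<Sum>j\<in>J. Polynomial.smult (b j) (error_locator \<alpha> (J - {j})))"

lemma degree_error_locator:
  assumes "\<And>j. j \<in> J \<Longrightarrow> \<alpha> j \<noteq> 0"
  shows "Polynomial.degree (error_locator \<alpha> J) = card J"
proof -
  have "Polynomial.degree (error_locator \<alpha> J) = (\<Sum>j\<in>J. Polynomial.degree [:1, - \<alpha> j:])"
    unfolding error_locator_def by (rule degree_prod_sum_eq) simp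
  also have "\<dots> = (\<Sum>j\<in>J. 1)"
    using assms by (intro sum.cong) auto
  finally show ?thesis by simp
qed

lemma error_locator_nonzero: "error_locator \<alpha> J \<noteq> 0"
proof (cases "finite J")
  case True
  then show ?thesis by (simp add: error_locator_def prod_zero_iff)
\<comment> \<open>Over an infinite index set the product defaults to 1.\<close>
qed (simp add: error_locator_def)

text \<open>For empty \<open>J\<close> the evaluator is 0, and its library degree 0 is not below
  \<open>card J = 0\<close>; that case is left to \<open>deg_inf\<close>.\<close>

lemma degree_error_evaluator_less:
  assumes "finite J" and "J \<noteq> {}" and "\<And>j. j \<in> J \<Longrightarrow> \<alpha> j \<noteq> 0"
  shows "Polynomial.degree (error_evaluator \<alpha> b J) < card J"
proof -
  have "Polynomial.degree (Polynomial.smult (b j) (error_locator \<alpha> (J - {j}))) \<le> card J - 1"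
    if "j \<in> J" for j
    using degree_smult_le[of "b j" "error_locator \<alpha> (J - {j})"] that assms
      degree_error_locator[of "J - {j}" \<alpha>] by simp
  then have "Polynomial.degree (error_evaluator \<alpha> b J) \<le> card J - 1"
    unfolding error_evaluator_def using assms(1) by (intro degree_sum_le) auto
  moreover have "0 < card J"
    using assms(1,2) by (simp add: card_gt_0_iff)
  ultimately show ?thesis by linarith
qed

text \<open>At the inverse of \<open>\<alpha> j\<close> every summand except the one for
  \<open>j\<close> contains a vanishing factor; the remaining one is nonzero because
  \<open>\<alpha>\<close> is injective on \<open>J\<close> and \<open>b j\<close> is
  nonzero.\<close>

lemma poly_error_evaluator_nonzero:
  assumes "finite J" and "inj_on \<alpha> J" and "j \<in> J" and "\<alpha> j \<noteq> 0" and "b j \<noteq> 0"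
  shows "poly (error_evaluator \<alpha> b J) (inverse (\<alpha> j)) \<noteq> 0"
proof -
  have other: "poly (error_locator \<alpha> (J - {i})) (inverse (\<alpha> j)) = 0" if "i \<in> J" "i \<noteq> j" for i
    unfolding error_locator_def poly_prod using assms that
    by (intro prod_zero) (auto intro!: bexI[of _ j])
  have self: "poly (error_locator \<alpha> (J - {j})) (inverse (\<alpha> j)) \<noteq> 0"
    unfolding error_locator_def poly_prod using assms
    by (auto simp: prod_zero_iff field_simps dest: inj_onD)
  have "poly (error_evaluator \<alpha> b J) (inverse (\<alpha> j)) =
      (\<Sum>i\<in>J. b i * poly (error_locator \<alpha> (J - {i})) (inverse (\<alpha> j)))"
    by (simp add: error_evaluator_def poly_sum)
  also have "\<dots> = b j * poly (error_locator \<alpha> (J - {j})) (inverse (\<alpha> j))"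
    using assms(1,3) other by (subst sum.remove[of _ j]) auto
  finally show ?thesis using self assms(5) by simp
qed

lemma coprime_error_locator_evaluator:
  assumes "finite J" and "inj_on \<alpha> J"
    and "\<And>j. j \<in> J \<Longrightarrow> \<alpha> j \<noteq> 0" and "\<And>j. j \<in> J \<Longrightarrow> b j \<noteq> 0"
  shows "coprime (error_locator \<alpha> J) (error_evaluator \<alpha> b J)"
  unfolding error_locator_def[of \<alpha> J] using assms
  by (intro coprime_prod_left_euclidean coprime_linear_poly poly_error_evaluator_nonzero) auto

section \<open>The key equation\<close>

text \<open>The telescoping geometric sum in \<open>a x\<close>: modulo \<open>x ^ m\<close> the
  truncated series is the inverse of \<open>1 - a x\<close>.\<close>

lemma linear_mult_geometric:
  fixes a :: "'a::field"
  shows "[:1, - a:] * (\<Sum>i<m. Polynomial.monom (a ^ i) i) =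
    1 - Polynomial.smult (a ^ m) (Polynomial.monom 1 m)"
proof -
  have "1 - Polynomial.monom a 1 ^ m =
      (1 - Polynomial.monom a 1) * (\<Sum>i<m. Polynomial.monom a 1 ^ i)"
    by (rule one_diff_power_eq)
  moreover have "1 - Polynomial.monom a 1 = [:1, - a:]"
    by (simp add: monom_Suc monom_0 one_pCons)
  ultimately show ?thesis
    by (simp add: Polynomial.monom_power Polynomial.smult_monom)
qed

lemma smult_sum_right: "Polynomial.smult c (sum p A) = (\<Sum>i\<in>A. Polynomial.smult c (p i))"
  by (simp add: poly_eq_iff coeff_sum sum_distrib_left)

lemma key_equation:
  assumes "finite J"
  shows "[(\<Sum>i<m. Polynomial.monom (\<Sum>j\<in>J. b j * \<alpha> j ^ i) i) * error_locator \<alpha> J =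
    error_evaluator \<alpha> b J] (mod Polynomial.monom 1 m)"
proof -
  let ?L = "\<lambda>j. error_locator \<alpha> (J - {j})"
  let ?G = "\<lambda>j. \<Sum>i<m. Polynomial.monom (\<alpha> j ^ i) i"
  let ?x = "Polynomial.monom 1 m"
  have "(\<Sum>i<m. Polynomial.monom (\<Sum>j\<in>J. b j * \<alpha> j ^ i) i) =
      (\<Sum>i<m. \<Sum>j\<in>J. Polynomial.smult (b j) (Polynomial.monom (\<alpha> j ^ i) i))"
    by (simp add: monom_sum Polynomial.smult_monom)
  \<comment> \<open>Exchanging the sums leaves one truncated geometric series per location.\<close>
  also have "\<dots> = (\<Sum>j\<in>J. Polynomial.smult (b j) (?G j))"
    by (subst sum.swap) (simp add: smult_sum_right)
  finally have "(\<Sum>i<m. Polynomial.monom (\<Sum>j\<in>J. b j * \<alpha> j ^ i) i) * error_locator \<alpha> J =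
      (\<Sum>j\<in>J. Polynomial.smult (b j) (?G j * error_locator \<alpha> J))"
    by (simp add: sum_distrib_right)
  also have "\<dots> = (\<Sum>j\<in>J. Polynomial.smult (b j) ((1 - Polynomial.smult (\<alpha> j ^ m) ?x) * ?L j))"
  proof (intro sum.cong refl)
    fix j assume "j \<in> J"
    \<comment> \<open>The locator supplies exactly the factor that collapses the series for
      \<open>j\<close>.\<close>
    then have "error_locator \<alpha> J = [:1, - \<alpha> j:] * ?L j"
      unfolding error_locator_def using assms by (rule prod.remove[rotated])
    then have "?G j * error_locator \<alpha> J = ([:1, - \<alpha> j:] * ?G j) * ?L j"
      by (simp only: ac_simps)
    then show "Polynomial.smult (b j) (?G j * error_locator \<alpha> J) =
        Polynomial.smult (b j) ((1 - Polynomial.smult (\<alpha> j ^ m) ?x) * ?L j)"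
      by (simp only: linear_mult_geometric)
  qed
  also have "\<dots> = error_evaluator \<alpha> b J - ?x * (\<Sum>j\<in>J. Polynomial.smult (b j * \<alpha> j ^ m) (?L j))"
    by (simp add: error_evaluator_def left_diff_distrib smult_diff_right sum_subtractf
        sum_distrib_left)
  finally show ?thesis
    by (simp add: cong_iff_dvd_diff)
qed

section \<open>Uniqueness of the pair up to a scalar\<close>

lemma key_pair_degree:
  assumes "key_pair t d J S \<sigma> \<tau>"
  shows "\<sigma> \<noteq> 0" and "Polynomial.degree \<sigma> = card J"
    and "\<tau> \<noteq> 0 \<Longrightarrow> Polynomial.degree \<tau> < card J"
  using assms by (auto simp: key_pair_def deg_inf_def split: if_splits)

text \<open>Each side is its own remainder. The zero alternatives matter for \<open>m = 0\<close>,
  which arises from \<open>t = 1\<close>, where no degree lies below \<open>m\<close>.\<close>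

lemma eq_if_cong_monom:
  fixes p q :: "'a::field poly"
  assumes "[p = q] (mod Polynomial.monom 1 m)"
    and "p = 0 \<or> Polynomial.degree p < m" and "q = 0 \<or> Polynomial.degree q < m"
  shows "p = q"
proof -
  have "r mod Polynomial.monom 1 m = r" if "r = 0 \<or> Polynomial.degree r < m" for r :: "'a poly"
    using that by (auto simp: mod_poly_less Polynomial.degree_monom_eq)
  with assms show ?thesis
    by (simp add: Cong.cong_def)
qed

lemma key_pair_unique:
  fixes S :: "'a::field poly"
  assumes k1: "key_pair t d J S \<sigma>1 \<tau>1" and k2: "key_pair t d J S \<sigma>2 \<tau>2"
    and small: "2 * card J \<le> t - 1"
  shows "\<exists>c. c \<noteq> 0 \<and> \<sigma>1 = Polynomial.smult c \<sigma>2 \<and> \<tau>1 = Polynomial.smult c \<tau>2"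
proof -
  note d1 = key_pair_degree[OF k1] and d2 = key_pair_degree[OF k2]
  let ?x = "Polynomial.monom (1::'a) (t - 1)"
  have c1: "[S * \<sigma>1 = \<tau>1] (mod ?x)" and c2: "[S * \<sigma>2 = \<tau>2] (mod ?x)"
    and cop: "coprime \<sigma>1 \<tau>1"
    using k1 k2 by (auto simp: key_pair_def)
  have "[\<sigma>1 * \<tau>2 = \<sigma>1 * (S * \<sigma>2)] (mod ?x)"
    using c2 by (intro cong_mult cong_refl) (rule cong_sym)
  also have "\<sigma>1 * (S * \<sigma>2) = \<sigma>2 * (S * \<sigma>1)"
    by (simp only: ac_simps)
  also have "[\<sigma>2 * (S * \<sigma>1) = \<sigma>2 * \<tau>1] (mod ?x)"
    using c1 by (intro cong_mult cong_refl)
  finally have "[\<sigma>1 * \<tau>2 = \<sigma>2 * \<tau>1] (mod ?x)" .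
  moreover have "\<sigma>1 * \<tau>2 = 0 \<or> Polynomial.degree (\<sigma>1 * \<tau>2) < t - 1"
    using d1 d2 small by (cases "\<tau>2 = 0") (auto simp: degree_mult_eq)
  moreover have "\<sigma>2 * \<tau>1 = 0 \<or> Polynomial.degree (\<sigma>2 * \<tau>1) < t - 1"
    using d1 d2 small by (cases "\<tau>1 = 0") (auto simp: degree_mult_eq)
  ultimately have eq: "\<sigma>1 * \<tau>2 = \<sigma>2 * \<tau>1"
    by (rule eq_if_cong_monom)
  then have "\<sigma>1 dvd \<sigma>2 * \<tau>1"
    by (metis dvd_triv_left)
  then have "\<sigma>1 dvd \<sigma>2"
    using cop by (rule coprime_dvd_mult_euclidean[rotated])
  then obtain q where q: "\<sigma>2 = \<sigma>1 * q" by blast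
  then have "q \<noteq> 0" using d2(1) by auto
  \<comment> \<open>Both \<open>\<sigma>1\<close> and \<open>\<sigma>2\<close> have degree
    \<open>card J\<close>, so the cofactor is constant.\<close>
  then have "Polynomial.degree q = 0"
    using degree_mult_eq[OF d1(1), of q] d1(2) d2(2) q by simp
  then obtain a where a: "q = [:a:]"
    by (rule degree_eq_zeroE)
  then have "a \<noteq> 0" using \<open>q \<noteq> 0\<close> by simp
  have s: "\<sigma>2 = Polynomial.smult a \<sigma>1"
    using q a by simp
  then have "\<sigma>1 * \<tau>2 = \<sigma>1 * Polynomial.smult a \<tau>1"
    using eq by simp
  then have "\<tau>2 = Polynomial.smult a \<tau>1"
    using d1(1) by (metis mult_left_cancel)
  with s \<open>a \<noteq> 0\<close> show ?thesis
    \<comment> \<open>Divisibility expressed the second pair through the first, so the required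
      scalar is the inverse.\<close>
    by (intro exI[of _ "inverse a"]) simp
qed

section \<open>Hamming distance and the closest codeword\<close>

text \<open>Where \<open>x\<close> and \<open>y\<close> differ, \<open>r\<close> differs from one of
  them. Both right-hand terms start from \<open>r\<close>, as in \<open>dist_to_code\<close>; the
  index range comes from the first argument, hence the dimension hypothesis.\<close>

lemma hamming_dist_triangle:
  assumes "dim_vec x = dim_vec r"
  shows "hamming_dist x y \<le> hamming_dist r x + hamming_dist r y"
proof -
  have "{j. j < dim_vec x \<and> x $ j \<noteq> y $ j} \<subseteq>
      {j. j < dim_vec r \<and> r $ j \<noteq> x $ j} \<union> {j. j < dim_vec r \<and> r $ j \<noteq> y $ j}"
    using assms by auto
  then have "hamming_dist x y \<le>
      card ({j. j < dim_vec r \<and> r $ j \<noteq> x $ j} \<union> {j. j < dim_vec r \<and> r $ j \<noteq> y $ j})"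
    unfolding hamming_dist_def by (intro card_mono) auto
  also have "\<dots> \<le> hamming_dist r x + hamming_dist r y"
    unfolding hamming_dist_def by (rule card_Un_le)
  finally show ?thesis .
qed

lemma hamming_dist_le_dim: "hamming_dist x y \<le> dim_vec x"
  unfolding hamming_dist_def
  using card_mono[of "{..<dim_vec x}" "{j. j < dim_vec x \<and> x $ j \<noteq> y $ j}"] by auto

lemma min_distance_le:
  assumes "C \<subseteq> carrier_vec n" and "x \<in> C" and "y \<in> C" and "x \<noteq> y"
  shows "min_distance C \<le> hamming_dist x y"
  unfolding min_distance_def
proof (rule Min_le)
  have "hamming_dist x y \<le> n" if "x \<in> C" for x y
    using hamming_dist_le_dim[of x y] assms(1) that by auto
  then have "{hamming_dist x y | x y. x \<in> C \<and> y \<in> C \<and> x \<noteq> y} \<subseteq> {..n}"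
    by blast
  then show "finite {hamming_dist x y | x y. x \<in> C \<and> y \<in> C \<and> x \<noteq> y}"
    using finite_subset by blast
qed (use assms in blast)

lemma dist_to_code_attained:
  assumes "C \<noteq> {}"
  shows "\<exists>c\<in>C. hamming_dist r c = dist_to_code r C"
proof -
  let ?D = "{hamming_dist r c | c. c \<in> C}"
  have "?D \<subseteq> {..dim_vec r}"
    using hamming_dist_le_dim by blast
  then have "finite ?D"
    using finite_subset by blast
  moreover have "?D \<noteq> {}"
    using assms by blast
  ultimately have "Min ?D \<in> ?D"
    by (rule Min_in)
  then show ?thesis
    unfolding dist_to_code_def by auto
qed

text \<open>Justifies the definite description: two codewords attaining the distance would be closer
  to each other than the minimum distance allows.\<close>

lemma closest_codeword:
  assumes C: "C \<subseteq> carrier_vec n" "C \<noteq> {}" and r: "r \<in> carrier_vec n"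
    and d: "0 < min_distance C" and close: "dist_to_code r C \<le> (min_distance C - 1) div 2"
  shows "closest_codeword r C \<in> C"
    and "hamming_dist r (closest_codeword r C) = dist_to_code r C"
proof -
  have "\<exists>!c. c \<in> C \<and> hamming_dist r c = dist_to_code r C"
  proof (rule ex_ex1I)
    show "\<exists>c. c \<in> C \<and> hamming_dist r c = dist_to_code r C"
      using dist_to_code_attained[OF C(2)] by blast
  next
    fix x y
    assume x: "x \<in> C \<and> hamming_dist r x = dist_to_code r C"
      and y: "y \<in> C \<and> hamming_dist r y = dist_to_code r C"
    have "x \<in> carrier_vec n"
      using x C(1) by blast
    then have "dim_vec x = dim_vec r"
      using r by simp
    then have "hamming_dist x y \<le> 2 * ((min_distance C - 1) div 2)"
      using hamming_dist_triangle[of x r y] x y close by simp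
    \<comment> \<open>Subtraction is truncated, so the strict bound needs a positive minimum
      distance.\<close>
    then have "hamming_dist x y < min_distance C"
      using d by linarith
    then show "x = y"
      using min_distance_le[OF C(1)] x y by (metis not_le)
  qed
  from theI'[OF this] show "closest_codeword r C \<in> C"
    and "hamming_dist r (closest_codeword r C) = dist_to_code r C"
    unfolding closest_codeword_def by blast+
qed

section \<open>Error word and syndromes\<close>

lemma card_error_locations:
  assumes "r \<in> carrier_vec n" and "closest_codeword r C \<in> carrier_vec n"
  shows "card (error_locations r C) = hamming_dist r (closest_codeword r C)"
  unfolding error_locations_def hamming_dist_def error_word_def using assms
  by (intro arg_cong[of _ _ card]) auto

text \<open>The last row of the parity-check matrix, the only one involving \<open>f\<close>, is excluded.\<close>

lemma mat_kernel_parity_matrix_power_sum: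
  assumes c: "c \<in> mat_kernel (parity_matrix t n \<alpha> w f)" and i: "i < t - 1"
  shows "(\<Sum>j<n. c $ j * w j * \<alpha> j ^ i) = 0"
proof -
  let ?H = "parity_matrix t n \<alpha> w f"
  have H: "?H \<in> carrier_mat t n"
    by (simp add: parity_matrix_def)
  have dim: "dim_vec c = n" and "?H *\<^sub>v c = 0\<^sub>v t"
    using mat_kernelD[OF H c] by auto
  then have "(?H *\<^sub>v c) $ i = 0"
    using i by simp
  then have "(\<Sum>j<n. w j * \<alpha> j ^ i * c $ j) = 0"
    using i dim by (simp add: parity_matrix_def scalar_prod_def atLeast0LessThan)
  then show ?thesis
    by (simp add: ac_simps)
qed

text \<open>The power sums of the codeword vanish and positions outside the error set contribute 0.
  This is the shape of \<open>key_equation\<close>, with error value times \<open>w j\<close> as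
  coefficient.\<close>

lemma syndrome_poly_error:
  assumes r: "r \<in> carrier_vec n" and c: "closest_codeword r C \<in> C"
    and C: "C = mat_kernel (parity_matrix t n \<alpha> w f)"
  shows "syndrome_poly t n \<alpha> w r =
    (\<Sum>i<t - 1. Polynomial.monom
      (\<Sum>j\<in>error_locations r C. error_word r C $ j * w j * \<alpha> j ^ i) i)"
  unfolding syndrome_poly_def
proof (rule sum.cong[OF refl])
  fix i assume "i \<in> {..<t - 1}"
  then have i: "i < t - 1" by simp
  let ?c = "closest_codeword r C" and ?e = "error_word r C"
  have "parity_matrix t n \<alpha> w f \<in> carrier_mat t n"
    by (simp add: parity_matrix_def)
  then have cc: "?c \<in> carrier_vec n"
    using c C mat_kernelD(1) by blast
  have e: "?e $ j = r $ j - ?c $ j" if "j < n" for j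
    using that r cc by (simp add: error_word_def)
  have "(\<Sum>j<n. r $ j * w j * \<alpha> j ^ i) =
      (\<Sum>j<n. r $ j * w j * \<alpha> j ^ i) - (\<Sum>j<n. ?c $ j * w j * \<alpha> j ^ i)"
    using mat_kernel_parity_matrix_power_sum[OF _ i] c C by simp
  also have "\<dots> = (\<Sum>j<n. ?e $ j * w j * \<alpha> j ^ i)"
    unfolding sum_subtractf[symmetric]
    by (intro sum.cong) (auto simp: e left_diff_distrib)
  also have "\<dots> = (\<Sum>j\<in>error_locations r C. ?e $ j * w j * \<alpha> j ^ i)"
    using r by (intro sum.mono_neutral_right) (auto simp: error_locations_def)
  finally show "Polynomial.monom (\<Sum>j<n. r $ j * w j * \<alpha> j ^ i) i =
      Polynomial.monom (\<Sum>j\<in>error_locations r C. ?e $ j * w j * \<alpha> j ^ i) i"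
    by simp
qed

theorem theorem4p1:
  fixes t n d :: nat
    and \<alpha> w :: "nat \<Rightarrow> 'a::{field, finite}"
    and f :: "'a poly"
    and H :: "'a mat"
    and C :: "'a vec set"
    and r :: "'a vec"
    and J :: "nat set"
    and S :: "'a poly"
  assumes "inj_on \<alpha> {..<n}"
    and "\<And>j. j < n \<Longrightarrow> \<alpha> j \<noteq> 0"
    and "\<And>j. j < n \<Longrightarrow> w j \<noteq> 0"
    and "1 \<le> t" and "t < n"
    and "H = parity_matrix t n \<alpha> w f"
    and "vec_space.rank t H = t"
    and "C = mat_kernel H"
    and "d = min_distance C"
    and "d = t \<or> (d = t + 1 \<and> odd t)"
    and "r \<in> carrier_vec n"
    and "dist_to_code r C \<le> (d - 1) div 2"
    and "J = error_locations r C"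
    and "S = syndrome_poly t n \<alpha> w r"
  shows "(\<exists>\<sigma> \<tau>. key_pair t d J S \<sigma> \<tau>) \<and>
    (\<forall>\<sigma>1 \<tau>1 \<sigma>2 \<tau>2. key_pair t d J S \<sigma>1 \<tau>1 \<and> key_pair t d J S \<sigma>2 \<tau>2 \<longrightarrow>
       (\<exists>c. c \<noteq> 0 \<and> \<sigma>1 = Polynomial.smult c \<sigma>2 \<and> \<tau>1 = Polynomial.smult c \<tau>2))"
proof -
  have H: "H \<in> carrier_mat t n"
    using assms(6) by (simp add: parity_matrix_def)
  have C: "C \<subseteq> carrier_vec n"
    using assms(8) mat_kernelD(1)[OF H] by blast
  have "0\<^sub>v n \<in> C"
    unfolding assms(8) using H by (intro mat_kernelI[OF H]) auto
  then have "C \<noteq> {}" by blast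
  then have c: "closest_codeword r C \<in> C"
    and dist: "hamming_dist r (closest_codeword r C) = dist_to_code r C"
    using closest_codeword[OF C _ assms(11)] assms(4,9,10,12) by auto
  have Jle: "card J \<le> (d - 1) div 2"
    using card_error_locations[OF assms(11)] c C dist assms(12,13) by auto
  \<comment> \<open>For \<open>d = t\<close> this is immediate. For \<open>d = t + 1\<close> the
    bound on \<open>card J\<close> is \<open>t div 2\<close>, and oddness of \<open>t\<close> makes
    its double equal to \<open>t - 1\<close>.\<close>
  then have small: "2 * card J \<le> t - 1"
    using assms(10) by (auto elim!: oddE)
  \<comment> \<open>These coefficients are nonzero on \<open>J\<close>, as coprimality
    requires.\<close>
  let ?b = "\<lambda>j. error_word r C $ j * w j"
  have J: "J \<subseteq> {..<n}" and nz: "error_word r C $ j \<noteq> 0" if "j \<in> J" for j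
    using assms(11,13) that by (auto simp: error_locations_def)
  have Jn: "J \<subseteq> {..<n}"
    using J by blast
  then have fin: "finite J"
    using finite_subset by blast
  have inj: "inj_on \<alpha> J"
    using assms(1) Jn inj_on_subset by blast
  have a: "\<alpha> j \<noteq> 0" and b: "?b j \<noteq> 0" if "j \<in> J" for j
    using assms(2,3) Jn nz that by auto
  let ?\<sigma> = "error_locator \<alpha> J" and ?\<tau> = "error_evaluator \<alpha> ?b J"
  have "S = (\<Sum>i<t - 1. Polynomial.monom (\<Sum>j\<in>J. ?b j * \<alpha> j ^ i) i)"
    using syndrome_poly_error[OF assms(11) c] assms(6,8,13,14) by simp
  then have "[S * ?\<sigma> = ?\<tau>] (mod Polynomial.monom 1 (t - 1))"
    using key_equation[OF fin] by simp
  moreover have "coprime ?\<sigma> ?\<tau>"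
    using fin inj a b by (rule coprime_error_locator_evaluator)
  moreover have deg: "deg_inf ?\<sigma> = ereal (real (card J))"
    using degree_error_locator[OF a] error_locator_nonzero[of \<alpha> J] by (simp add: deg_inf_def)
  moreover have "deg_inf ?\<tau> < deg_inf ?\<sigma>"
  proof (cases "J = {}")
    \<comment> \<open>The evaluator is an empty sum, so its degree is minus infinity, below
      \<open>card J = 0\<close>.\<close>
    case True
    then show ?thesis
      using deg by (simp add: deg_inf_def error_evaluator_def)
  next
    case False
    then show ?thesis
      using degree_error_evaluator_less[OF fin False a] deg by (simp add: deg_inf_def)
  qed
  ultimately have "key_pair t d J S ?\<sigma> ?\<tau>"
    using Jle by (simp add: key_pair_def)
  then show ?thesis
    using key_pair_unique small by blast
qed

end
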